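(* Let $\lambda_1,\lambda_2,\lambda_3\in\mathbb{C}^*$ satisfy $(\lambda_1^2+\lambda_2\lambda_3)(\lambda_2^2+\lambda_1\lambda_3)(\lambda_3^2+\lambda_1\lambda_2)\neq 0$ and $\lambda_2\neq-\lambda_3$, and let $\mu: B_3\to\mathrm{GL}_3(\mathbb{C})$ be the representation $$\mu(\sigma_1)=\begin{pmatrix} \lambda_1 & \lambda_1\lambda_2^{-1}\lambda_3+\lambda_2 & \lambda_2 \\ 0 & \lambda_2 & \lambda_2 \\ 0 & 0 & \lambda_3 \end{pmatrix},\qquad \mu(\sigma_2)=\begin{pmatrix} \lambda_3 & 0 & 0 \\ -\lambda_2 & \lambda_2 & 0 \\ \lambda_2 & -\lambda_1\lambda_2^{-1}\lambda_3-\lambda_2 & \lambda_1 \end{pmatrix}.$$ Let $\rho: SB_3\to\mathrm{GL}_3(\mathbb{C})$ be a representation that extends $\mu$, i.e. $\rho(\sigma_1)=\mu(\sigma_1)$ and $\rho(\sigma_2)=\mu(\sigma_2)$. Then $$\rho(\tau_1)=\begin{pmatrix} a_1 & b_1 & c_1 \\ 0 & e_1 & f_1 \\ 0 & 0 & i_1 \end{pmatrix},\qquad \rho(\tau_2)=\begin{pmatrix} a_2 & 0 & 0 \\ d_2 & e_2 & 0 \\ g_2 & h_2 & i_2 \end{pmatrix},$$ for some $a_1,b_1,c_1,e_1,f_1,i_1,a_2,d_2,e_2,g_2,h_2,i_2\in\mathbb{C}$ with $a_1,e_1,i_1,a_2,e_2,i_2$ all nonzero and $$a_1=i_2=\frac{c_1\lambda_2(\lambda_1-\lambda_2)(\lambda_1-\lambda_3)+e_1\lambda_1\lambda_2(\lambda_2+\lambda_3)+f_1\lambda_3(\lambda_1-\lambda_2)(\lambda_1+\lambda_2)}{\lambda_1\lambda_2(\lambda_2+\lambda_3)},$$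 $$b_1=-h_2=\frac{(\lambda_1\lambda_3+\lambda_2^2)\bigl(c_1\lambda_2(\lambda_1-\lambda_3)+f_1\lambda_3(\lambda_1+\lambda_2)\bigr)}{\lambda_1\lambda_2^2(\lambda_2+\lambda_3)},$$ $$i_1=a_2=e_1+f_1\Bigl(\frac{\lambda_3}{\lambda_2}-1\Bigr),\qquad d_2=-f_1,\qquad e_2=e_1,\qquad g_2=c_1.$$
   Context: The braid group $B_3$ is generated by $\sigma_1,\sigma_2$ with the relation $\sigma_1\sigma_2\sigma_1=\sigma_2\sigma_1\sigma_2$. The singular braid group $SB_3$ is the group generated by $\sigma_1,\sigma_2,\tau_1,\tau_2$ with defining relations $\sigma_1\sigma_2\sigma_1=\sigma_2\sigma_1\sigma_2$, $\tau_1\sigma_1=\sigma_1\tau_1$, $\tau_2\sigma_2=\sigma_2\tau_2$, $\sigma_1\sigma_2\tau_1=\tau_2\sigma_1\sigma_2$, $\sigma_2\sigma_1\tau_2=\tau_1\sigma_2\sigma_1$. *)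

theory Defs
  imports "HOL-Analysis.Analysis" "HOL-Algebra.Group"
begin

text \<open>
  Group presentations. A letter \<open>(g, True)\<close> stands for the generator \<open>g\<close>
  and \<open>(g, False)\<close> for its formal inverse. The presented group consists of the words in these
  letters, modulo the smallest congruence that cancels adjacent inverse letters and identifies
  the two sides of every defining relation.
\<close>

type_synonym 'g word = "('g \<times> bool) list"

inductive word_eq :: "('g word \<times> 'g word) set \<Rightarrow> 'g word \<Rightarrow> 'g word \<Rightarrow> bool"
  for R :: "('g word \<times> 'g word) set" where
  refl: "word_eq R u u"
| sym: "word_eq R u v \<Longrightarrow> word_eq R v u"
| trans: "word_eq R u v \<Longrightarrow> word_eq R v w \<Longrightarrow> word_eq R u w"
| cancel: "word_eq R (u @ [(g, b), (g, \<not> b)] @ v) (u @ v)"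
| relation: "(l, r) \<in> R \<Longrightarrow> word_eq R (u @ l @ v) (u @ r @ v)"

definition word_class :: "('g word \<times> 'g word) set \<Rightarrow> 'g word \<Rightarrow> 'g word set" where
  "word_class R u = {v. word_eq R u v}"

definition presented_group :: "('g word \<times> 'g word) set \<Rightarrow> 'g word set monoid" where
  "presented_group R =
    \<lparr>carrier = range (word_class R),
     mult = (\<lambda>A B. \<Union>u\<in>A. \<Union>v\<in>B. word_class R (u @ v)),
     one = word_class R []\<rparr>"

definition pos :: "'g \<Rightarrow> 'g \<times> bool" where
  "pos g = (g, True)"

definition gen :: "('g word \<times> 'g word) set \<Rightarrow> 'g \<Rightarrow> 'g word set" where
  "gen R g = word_class R [pos g]"

datatype braid_gen = B\<sigma>1 | B\<sigma>2

definition braid_rels :: "(braid_gen word \<times> braid_gen word) set" where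
  "braid_rels = {(map pos [B\<sigma>1, B\<sigma>2, B\<sigma>1], map pos [B\<sigma>2, B\<sigma>1, B\<sigma>2])}"

definition B3 :: "braid_gen word set monoid" where
  "B3 = presented_group braid_rels"

datatype singular_braid_gen = S\<sigma>1 | S\<sigma>2 | S\<tau>1 | S\<tau>2

definition singular_braid_rels ::
    "(singular_braid_gen word \<times> singular_braid_gen word) set" where
  "singular_braid_rels =
    {(map pos [S\<sigma>1, S\<sigma>2, S\<sigma>1], map pos [S\<sigma>2, S\<sigma>1, S\<sigma>2]),
     (map pos [S\<tau>1, S\<sigma>1], map pos [S\<sigma>1, S\<tau>1]),
     (map pos [S\<tau>2, S\<sigma>2], map pos [S\<sigma>2, S\<tau>2]),
     (map pos [S\<sigma>1, S\<sigma>2, S\<tau>1], map pos [S\<tau>2, S\<sigma>1, S\<sigma>2]),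
     (map pos [S\<sigma>2, S\<sigma>1, S\<tau>2], map pos [S\<tau>1, S\<sigma>2, S\<sigma>1])}"

definition SB3 :: "singular_braid_gen word set monoid" where
  "SB3 = presented_group singular_braid_rels"

definition GL :: "('a::field ^ 'n ^ 'n) monoid" where
  "GL = \<lparr>carrier = {A. invertible A}, mult = (**), one = mat 1\<rparr>"

definition mat3 :: "'a \<Rightarrow> 'a \<Rightarrow> 'a \<Rightarrow> 'a \<Rightarrow> 'a \<Rightarrow> 'a \<Rightarrow> 'a \<Rightarrow> 'a \<Rightarrow> 'a \<Rightarrow> 'a::zero ^ 3 ^ 3" where
  "mat3 a b c d e f g h i =
    vector [vector [a, b, c],
            vector [d, e, f],
            vector [g, h, i]]"

definition mu_sigma1 :: "complex \<Rightarrow> complex \<Rightarrow> complex \<Rightarrow> complex ^ 3 ^ 3" where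
  "mu_sigma1 l1 l2 l3 = mat3
     l1  (l1 * inverse l2 * l3 + l2)  l2
     0   l2                           l2
     0   0                            l3"

definition mu_sigma2 :: "complex \<Rightarrow> complex \<Rightarrow> complex \<Rightarrow> complex ^ 3 ^ 3" where
  "mu_sigma2 l1 l2 l3 = mat3
     l3      0                                0
     (- l2)  l2                               0
     l2      (- l1 * inverse l2 * l3 - l2)    l1"

lemma word_eq_append_left: "word_eq R u v \<Longrightarrow> word_eq R (w @ u) (w @ v)"
proof (induction rule: word_eq.induct)
  case (refl u)
  show ?case by (rule word_eq.refl)
next
  case (sym u v)
  then show ?case by (blast intro: word_eq.sym)
next
  case (trans u v w')
  show ?case using trans.IH by (rule word_eq.trans)
next
  case (cancel u g b v)
  show ?case using word_eq.cancel[of R "w @ u" g b v] by simp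
next
  case (relation l r u v)
  then show ?case using word_eq.relation[of l r R "w @ u" v] by simp
qed

lemma word_eq_append_right: "word_eq R u v \<Longrightarrow> word_eq R (u @ w) (v @ w)"
proof (induction rule: word_eq.induct)
  case (refl u)
  show ?case by (rule word_eq.refl)
next
  case (sym u v)
  then show ?case by (blast intro: word_eq.sym)
next
  case (trans u v w')
  show ?case using trans.IH by (rule word_eq.trans)
next
  case (cancel u g b v)
  show ?case using word_eq.cancel[of R u g b "v @ w"] by simp
next
  case (relation l r u v)
  then show ?case using word_eq.relation[of l r R u "v @ w"] by simp
qed

lemma word_eq_append:
  "word_eq R u u' \<Longrightarrow> word_eq R v v' \<Longrightarrow> word_eq R (u @ v) (u' @ v')"
  by (meson word_eq.trans word_eq_append_left word_eq_append_right)

lemma word_class_eq_iff: "word_class R u = word_class R v \<longleftrightarrow> word_eq R u v"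
  unfolding word_class_def
  by (metis (mono_tags, lifting) Collect_cong mem_Collect_eq word_eq.refl word_eq.sym word_eq.trans)

lemma mult_word_class:
  "word_class R u \<otimes>\<^bsub>presented_group R\<^esub> word_class R v = word_class R (u @ v)"
proof -
  have 1: "word_class R (u' @ v') = word_class R (u @ v)"
    if "u' \<in> word_class R u" "v' \<in> word_class R v" for u' v'
    using that word_eq_append[of R u u' v v'] word_eq.sym
    by (auto simp: word_class_eq_iff) (auto simp: word_class_def)
  have 2: "u \<in> word_class R u" "v \<in> word_class R v"
    by (auto simp: word_class_def word_eq.refl)
  have "(\<Union>u'\<in>word_class R u. \<Union>v'\<in>word_class R v. word_class R (u' @ v')) =
        (\<Union>u'\<in>word_class R u. \<Union>v'\<in>word_class R v. word_class R (u @ v))"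
    by (rule SUP_cong[OF HOL.refl], rule SUP_cong[OF HOL.refl], rule 1)
  also have "\<dots> = word_class R (u @ v)"
    using 2 by blast
  finally show ?thesis by (simp add: presented_group_def)
qed

lemma one_presented_group: "\<one>\<^bsub>presented_group R\<^esub> = word_class R []"
  by (simp add: presented_group_def)

lemma carrier_presented_group: "carrier (presented_group R) = range (word_class R)"
  by (simp add: presented_group_def)

lemma gen_in_carrier: "gen R g \<in> carrier (presented_group R)"
  by (simp add: gen_def carrier_presented_group)

definition inv_word :: "'g word \<Rightarrow> 'g word" where
  "inv_word u = rev (map (\<lambda>(g, b). (g, \<not> b)) u)"

lemma inv_word_append: "word_eq R (inv_word u @ u) []"
proof (induction u)
  case Nil
  show ?case by (simp add: inv_word_def word_eq.refl)
next
  case (Cons x u)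
  obtain g b where x: "x = (g, b)" by force
  have "word_eq R (inv_word u @ [(g, \<not> b), (g, \<not> \<not> b)] @ u) (inv_word u @ u)"
    by (rule word_eq.cancel)
  then have "word_eq R (inv_word (x # u) @ x # u) (inv_word u @ u)"
    by (simp add: inv_word_def x)
  then show ?case using Cons word_eq.trans by blast
qed

lemma group_presented_group: "group (presented_group R)"
proof (rule groupI)
  fix x assume "x \<in> carrier (presented_group R)"
  then obtain u where x: "x = word_class R u" by (auto simp: carrier_presented_group)
  have "word_class R (inv_word u) \<otimes>\<^bsub>presented_group R\<^esub> x = \<one>\<^bsub>presented_group R\<^esub>"
    by (simp add: x mult_word_class one_presented_group word_class_eq_iff inv_word_append)
  then show "\<exists>y\<in>carrier (presented_group R). y \<otimes>\<^bsub>presented_group R\<^esub> x = \<one>\<^bsub>presented_group R\<^esub>"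
    by (auto simp: carrier_presented_group)
qed (auto simp: carrier_presented_group one_presented_group mult_word_class)

lemma word_class_relation: "(l, r) \<in> R \<Longrightarrow> word_class R l = word_class R r"
  using word_eq.relation[of l r R "[]" "[]"] by (simp add: word_class_eq_iff)

definition word_val :: "('a, 'm) monoid_scheme \<Rightarrow> ('g \<Rightarrow> 'a) \<Rightarrow> 'g word \<Rightarrow> 'a" where
  "word_val G f u =
    foldr (\<lambda>(g, b) x. (if b then f g else inv\<^bsub>G\<^esub> f g) \<otimes>\<^bsub>G\<^esub> x) u \<one>\<^bsub>G\<^esub>"

context group
begin

lemma word_val_closed:
  assumes "\<And>g. f g \<in> carrier G"
  shows "word_val G f u \<in> carrier G"
  using assms by (induction u) (auto simp: word_val_def)

lemma word_val_append:
  assumes "\<And>g. f g \<in> carrier G"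
  shows "word_val G f (u @ v) = word_val G f u \<otimes> word_val G f v"
proof (induction u)
  case Nil
  show ?case using word_val_closed[of f v] assms by (simp add: word_val_def)
next
  case (Cons x u)
  then show ?case
    using word_val_closed[of f u] word_val_closed[of f v] assms
    by (cases x) (auto simp: word_val_def m_assoc)
qed

lemma word_val_word_eq:
  assumes f: "\<And>g. f g \<in> carrier G"
    and rels: "\<And>l r. (l, r) \<in> R \<Longrightarrow> word_val G f l = word_val G f r"
    and "word_eq R u v"
  shows "word_val G f u = word_val G f v"
  using assms(3)
proof (induction rule: word_eq.induct)
  case (cancel u g b v)
  have "word_val G f [(g, b), (g, \<not> b)] = \<one>"
    using f by (cases b) (auto simp: word_val_def)
  then show ?case
    using word_val_closed[of f, OF f] by (simp only: word_val_append[of f, OF f] l_one)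
qed (auto simp: word_val_append[of f, OF f] rels)

lemma presented_group_universal:
  assumes f: "\<And>g. f g \<in> carrier G"
    and rels: "\<And>l r. (l, r) \<in> R \<Longrightarrow> word_val G f l = word_val G f r"
  shows "\<exists>h \<in> hom (presented_group R) G. \<forall>g. h (gen R g) = f g"
proof
  define h where "h = (\<lambda>A. word_val G f (SOME u. u \<in> A))"
  have h: "h (word_class R u) = word_val G f u" for u
  proof -
    have "u \<in> word_class R u" by (simp add: word_class_def word_eq.refl)
    then have "(SOME v. v \<in> word_class R u) \<in> word_class R u" by (rule someI)
    then show ?thesis
      unfolding h_def using word_val_word_eq[of f R, OF f rels] by (metis mem_Collect_eq word_class_def)
  qed
  show "h \<in> hom (presented_group R) G"
    by (rule homI)
      (auto simp: carrier_presented_group h mult_word_class word_val_closed[of f, OF f] word_val_append[of f, OF f])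
  show "\<forall>g. h (gen R g) = f g"
    using f by (simp add: gen_def h word_val_def pos_def)
qed

end

lemma group_GL: "group (GL :: ('a::field ^ 'n ^ 'n) monoid)"
proof (rule groupI)
  fix A :: "'a ^ 'n ^ 'n" assume "A \<in> carrier GL"
  then show "\<exists>B\<in>carrier GL. B \<otimes>\<^bsub>GL\<^esub> A = \<one>\<^bsub>GL\<^esub>"
    unfolding GL_def invertible_def by auto
next
  show "\<one>\<^bsub>GL\<^esub> \<in> carrier (GL :: ('a ^ 'n ^ 'n) monoid)"
    by (auto simp: GL_def invertible_def)
qed (auto simp: GL_def invertible_mult matrix_mul_assoc)

lemma mu_exists:
  assumes "l1 \<noteq> 0" "l2 \<noteq> 0" "l3 \<noteq> 0"
  shows "\<exists>\<mu> \<in> hom B3 GL. \<mu> (gen braid_rels B\<sigma>1) = mu_sigma1 l1 l2 l3 \<and>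
                          \<mu> (gen braid_rels B\<sigma>2) = mu_sigma2 l1 l2 l3"
proof -
  interpret GL: group "GL :: (complex ^ 3 ^ 3) monoid" by (rule group_GL)
  define f where "f = case_braid_gen (mu_sigma1 l1 l2 l3) (mu_sigma2 l1 l2 l3)"
  have det: "det (mu_sigma1 l1 l2 l3) = l1 * l2 * l3" "det (mu_sigma2 l1 l2 l3) = l1 * l2 * l3"
    by (simp_all add: mu_sigma1_def mu_sigma2_def mat3_def det_3 vector_3)
  have f: "f g \<in> carrier GL" for g
    using det assms by (cases g) (auto simp: f_def GL_def invertible_det_nz)
  have braid: "mu_sigma1 l1 l2 l3 ** (mu_sigma2 l1 l2 l3 ** mu_sigma1 l1 l2 l3) =
               mu_sigma2 l1 l2 l3 ** (mu_sigma1 l1 l2 l3 ** mu_sigma2 l1 l2 l3)"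
    using assms
    by (simp add: vec_eq_iff forall_3 matrix_matrix_mult_def sum_3 mu_sigma1_def mu_sigma2_def
          mat3_def vector_3 field_simps)
  have "\<exists>h \<in> hom (presented_group braid_rels) GL. \<forall>g. h (gen braid_rels g) = f g"
  proof (rule GL.presented_group_universal[of f, OF f])
    fix l r assume "(l, r) \<in> braid_rels"
    then show "word_val GL f l = word_val GL f r"
      using braid by (simp add: braid_rels_def word_val_def pos_def f_def GL_def)
  qed
  then obtain h where h: "h \<in> hom (presented_group braid_rels) GL"
    "\<And>g. h (gen braid_rels g) = f g" by blast
  show ?thesis
    unfolding B3_def
  proof (intro bexI conjI)
    show "h (gen braid_rels B\<sigma>1) = mu_sigma1 l1 l2 l3" by (simp add: h(2) f_def)
    show "h (gen braid_rels B\<sigma>2) = mu_sigma2 l1 l2 l3" by (simp add: h(2) f_def)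
  qed (rule h(1))
qed

end

theory Submission
  imports Defs
begin

text \<open>
  The matrix of \<open>\<tau>\<^sub>1\<close> commutes with the upper triangular matrix of \<open>\<sigma>\<^sub>1\<close>, whose superdiagonal has
  no zero; together with \<open>\<lambda>\<^sub>2 \<noteq> -\<lambda>\<^sub>3\<close> this makes \<open>\<sigma>\<^sub>1\<close> nonderogatory even when eigenvalues
  coincide, so its centralizer is three-dimensional and upper triangular, and linear elimination
  expresses all entries through \<open>c\<^sub>1, e\<^sub>1, f\<^sub>1\<close>. The matrix of \<open>\<sigma>\<^sub>1\<sigma>\<^sub>2\<close> is invertible, hence
  \<open>\<sigma>\<^sub>1\<sigma>\<^sub>2\<tau>\<^sub>1 = \<tau>\<^sub>2\<sigma>\<^sub>1\<sigma>\<^sub>2\<close> determines \<open>\<tau>\<^sub>2\<close>.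
\<close>

lemma mat3_nth [simp]:
  "mat3 a b c d e f g h i $ 1 $ 1 = a" "mat3 a b c d e f g h i $ 1 $ 2 = b"
  "mat3 a b c d e f g h i $ 1 $ 3 = c" "mat3 a b c d e f g h i $ 2 $ 1 = d"
  "mat3 a b c d e f g h i $ 2 $ 2 = e" "mat3 a b c d e f g h i $ 2 $ 3 = f"
  "mat3 a b c d e f g h i $ 3 $ 1 = g" "mat3 a b c d e f g h i $ 3 $ 2 = h"
  "mat3 a b c d e f g h i $ 3 $ 3 = i"
  by (simp_all add: mat3_def)

lemma mat3_eq_iff:
  "mat3 a b c d e f g h i = mat3 a' b' c' d' e' f' g' h' i' \<longleftrightarrow>
    a = a' \<and> b = b' \<and> c = c' \<and> d = d' \<and> e = e' \<and> f = f' \<and> g = g' \<and> h = h' \<and> i = i'"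
  by (simp add: vec_eq_iff forall_3)

lemma mat3_surj:
  obtains a b c d e f g h i where "A = mat3 a b c d e f g h i"
proof
  show "A = mat3 (A$1$1) (A$1$2) (A$1$3) (A$2$1) (A$2$2) (A$2$3) (A$3$1) (A$3$2) (A$3$3)"
    by (simp add: vec_eq_iff forall_3)
qed

lemma mat3_mult:
  fixes a :: "'a::semiring_1"
  shows "mat3 a b c d e f g h i ** mat3 a' b' c' d' e' f' g' h' i' =
    mat3 (a*a' + b*d' + c*g') (a*b' + b*e' + c*h') (a*c' + b*f' + c*i')
         (d*a' + e*d' + f*g') (d*b' + e*e' + f*h') (d*c' + e*f' + f*i')
         (g*a' + h*d' + i*g') (g*b' + h*e' + i*h') (g*c' + h*f' + i*i')"
  by (simp add: vec_eq_iff forall_3 matrix_matrix_mult_def sum_3)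

text \<open>The bottom row of the commutation equation forces \<open>h = - g\<close> and then
  \<open>g = 0\<close>. After that the (2,2) entry kills \<open>d\<close>, since \<open>u\<close> is
  nonzero. The last three conclusions are the (1,2), (2,3) and (1,3) entries.\<close>

lemma mu_sigma1_commute:
  fixes l1 l2 l3 a b c d e f g h i u :: complex
  defines "u \<equiv> l1 * inverse l2 * l3 + l2"
  assumes nz: "l1 \<noteq> 0" "l2 \<noteq> 0" "l3 \<noteq> 0" "l2^2 + l1 * l3 \<noteq> 0" "l2 \<noteq> - l3"
    and comm: "mat3 a b c d e f g h i ** mu_sigma1 l1 l2 l3 =
               mu_sigma1 l1 l2 l3 ** mat3 a b c d e f g h i"
  shows "d = 0" "g = 0" "h = 0"
    and "u * (a - e) = (l1 - l2) * b"
    and "l2 * (i - e) = (l3 - l2) * f"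
    and "l2 * (a - i) = (l1 - l3) * c + u * f - l2 * b"
proof -
  have u: "l2 * u = l1 * l3 + l2^2"
    using nz by (simp add: u_def field_simps power2_eq_square)
  then have "u \<noteq> 0" using nz by (auto simp: add.commute)
  have "a * u + b * l2 = l1 * b + u * e + l2 * h"
    and "a * l2 + b * l2 + c * l3 = l1 * c + u * f + l2 * i"
    and "d * u + e * l2 = l2 * e + l2 * h"
    and "d * l2 + e * l2 + f * l3 = l2 * f + l2 * i"
    and "g * l1 = l3 * g" "g * u + h * l2 = l3 * h" "g * l2 + h * l2 + i * l3 = l3 * i"
    using comm unfolding mu_sigma1_def u_def[symmetric] mat3_mult mat3_eq_iff
    by (simp_all only: mult_zero_left mult_zero_right add_0_left add_0_right)
  note E = this
  have "l2 * (g + h) = 0" using E(7) by (simp add: algebra_simps)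
  then have h: "h = - g" using nz by (simp add: add_eq_0_iff)
  \<comment> \<open>Multiplying the (3,2) entry by \<open>l2\<close> lets \<open>l2 * u\<close> be
    replaced by a polynomial, and the \<open>l2^2\<close> terms cancel.\<close>
  have "l3 * (l1 + l2) * g = l2 * (g * u + h * l2 - l3 * h)"
  proof -
    have "l2 * (g * u + h * l2 - l3 * h) = g * (l2 * u) - g * l2^2 + l2 * l3 * g"
      by (simp add: h algebra_simps power2_eq_square)
    then show ?thesis by (simp add: u algebra_simps)
  qed
  then have "l1 + l2 = 0 \<or> g = 0" using E(6) nz by simp
  moreover have "l1 = l3 \<or> g = 0" using E(5) by (auto simp: mult.commute)
  \<comment> \<open>A nonzero \<open>g\<close> would give \<open>l1 = - l2\<close> and
    \<open>l1 = l3\<close>, contradicting \<open>l2 \<noteq> - l3\<close>.\<close>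
  ultimately show g: "g = 0" using nz by (auto simp: add_eq_0_iff)
  with h show h: "h = 0" by simp
  have "d * u = 0" using E(3) h by (simp add: algebra_simps)
  then show d: "d = 0" using \<open>u \<noteq> 0\<close> by simp
  show "u * (a - e) = (l1 - l2) * b" using E(1) h by (simp add: algebra_simps)
  show "l2 * (i - e) = (l3 - l2) * f" using E(4) d by (simp add: algebra_simps)
  show "l2 * (a - i) = (l1 - l3) * c + u * f - l2 * b" using E(2) by (simp add: algebra_simps)
qed

text \<open>The elimination divides only by \<open>l1\<close>, \<open>l2\<close>,
  \<open>l2 + l3\<close> and \<open>u\<close>, never by a difference of eigenvalues, so coinciding
  eigenvalues need no separate case.\<close>

lemma centralizer_entries:
  fixes l1 l2 l3 a b c e f i u :: complex
  assumes nz: "l1 \<noteq> 0" "l2 \<noteq> 0" "l2 + l3 \<noteq> 0" "u \<noteq> 0"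
    and u: "l2 * u = l1 * l3 + l2^2"
    and ab: "u * (a - e) = (l1 - l2) * b"
    and ie: "l2 * (i - e) = (l3 - l2) * f"
    and ai: "l2 * (a - i) = (l1 - l3) * c + u * f - l2 * b"
  shows "a = (c * l2 * (l1 - l2) * (l1 - l3) + e * l1 * l2 * (l2 + l3)
             + f * l3 * (l1 - l2) * (l1 + l2)) / (l1 * l2 * (l2 + l3))"
    and "b = ((l1 * l3 + l2^2) * (c * l2 * (l1 - l3) + f * l3 * (l1 + l2)))
               / (l1 * l2^2 * (l2 + l3))"
    and "i = e + f * (l3 / l2 - 1)"
proof -
  show "i = e + f * (l3 / l2 - 1)"
    using ie nz by (simp add: field_simps)
  let ?X = "c * l2 * (l1 - l3) + f * l3 * (l1 + l2)"
  let ?K = "(l1 - l3) * c + u * f - l2 * b + (l3 - l2) * f"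
  let ?w = "l1 * l3 + l2^2"
  have "l2 * (a - e) = l2 * (a - i) + l2 * (i - e)"
    by (simp add: algebra_simps)
  then have ae: "l2 * (a - e) = ?K"
    unfolding ai ie .
  \<comment> \<open>Both \<open>ab\<close> and \<open>ae\<close> evaluate \<open>a - e\<close>;
    equating them leaves an equation free of \<open>a\<close> and \<open>i\<close>, linear in
    \<open>b\<close>.\<close>
  have "(l2 * u) * (l2 * (a - e)) = l2^2 * (u * (a - e))"
    by (simp add: algebra_simps power2_eq_square)
  then have K: "?w * ?K = l2^2 * ((l1 - l2) * b)"
    unfolding ae ab unfolding u .
  have "l2 * ?K + l2^2 * b = l2 * (l1 - l3) * c + (l2 * u) * f + l2 * (l3 - l2) * f"
    by (simp add: algebra_simps power2_eq_square)
  also have "\<dots> = ?X"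
    unfolding u by (simp add: algebra_simps power2_eq_square)
  finally have "?w * ?X = ?w * (l2 * ?K + l2^2 * b)"
    by simp
  also have "\<dots> = l2 * (?w * ?K) + ?w * l2^2 * b"
    by (simp only: distrib_left ac_simps)
  \<comment> \<open>The coefficient of \<open>b\<close> is
    \<open>l2^2 * (l2 * (l1 - l2) + ?w)\<close>; the inner squares of \<open>l2\<close> cancel,
    which produces the factor \<open>l2 + l3\<close>.\<close>
  also have "\<dots> = l1 * l2^2 * (l2 + l3) * b"
    unfolding K by (simp add: algebra_simps power2_eq_square)
  finally have b: "l1 * l2^2 * (l2 + l3) * b = ?w * ?X" ..
  then show "b = ((l1 * l3 + l2^2) * (c * l2 * (l1 - l3) + f * l3 * (l1 + l2)))
               / (l1 * l2^2 * (l2 + l3))"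
    using nz by (simp add: eq_divide_eq ac_simps)
  \<comment> \<open>Inserting \<open>b\<close> into \<open>ab\<close> puts the nonzero factor
    \<open>?w = l2 * u\<close> on both sides, so it cancels from the formula for
    \<open>a\<close>.\<close>
  have "(l2 * u) * (l1 * l2 * (l2 + l3) * (a - e)) = l1 * l2^2 * (l2 + l3) * (u * (a - e))"
    by (simp add: algebra_simps power2_eq_square)
  also have "\<dots> = (l1 - l2) * (l1 * l2^2 * (l2 + l3) * b)"
    unfolding ab by (simp only: ac_simps)
  also have "\<dots> = (l2 * u) * ((l1 - l2) * ?X)"
    unfolding b u by (simp only: ac_simps)
  finally have "l1 * l2 * (l2 + l3) * (a - e) = (l1 - l2) * ?X"
    using nz by simp
  then have "l1 * l2 * (l2 + l3) * a =
        c * l2 * (l1 - l2) * (l1 - l3) + e * l1 * l2 * (l2 + l3) + f * l3 * (l1 - l2) * (l1 + l2)"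
    by (simp add: algebra_simps)
  then show "a = (c * l2 * (l1 - l2) * (l1 - l3) + e * l1 * l2 * (l2 + l3)
             + f * l3 * (l1 - l2) * (l1 + l2)) / (l1 * l2 * (l2 + l3))"
    using nz by (simp add: eq_divide_eq ac_simps)
qed

text \<open>The leftmost matrix is the conjugate of the upper triangular one by the antidiagonal
  matrix with entries 1, -1, 1. The same conjugation exchanges \<open>mu_sigma1\<close> and
  \<open>mu_sigma2\<close>, which suggests it as the image of the second singular generator.\<close>

lemma mu_intertwines:
  fixes l1 l2 l3 a b c e f i u :: complex
  defines "u \<equiv> l1 * inverse l2 * l3 + l2"
  assumes nz: "l2 \<noteq> 0"
    and ab: "u * (a - e) = (l1 - l2) * b"
    and ie: "l2 * (i - e) = (l3 - l2) * f"
    and ai: "l2 * (a - i) = (l1 - l3) * c + u * f - l2 * b"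
  shows "mat3 i 0 0 (- f) e 0 c (- b) a ** (mu_sigma1 l1 l2 l3 ** mu_sigma2 l1 l2 l3) =
         (mu_sigma1 l1 l2 l3 ** mu_sigma2 l1 l2 l3) ** mat3 a b c 0 e f 0 0 i"
proof -
  have u: "l2 * u = l1 * l3 + l2^2"
    using nz by (simp add: u_def field_simps power2_eq_square)
  have u': "- l1 * inverse l2 * l3 - l2 = - u"
    by (simp add: u_def)
  have P: "mu_sigma1 l1 l2 l3 ** mu_sigma2 l1 l2 l3 =
      mat3 0 0 (l1 * l2) 0 (- (l1 * l3)) (l1 * l2) (l2 * l3) (- (l3 * u)) (l1 * l3)"
    unfolding mu_sigma1_def mu_sigma2_def u' u_def[symmetric] mat3_mult mat3_eq_iff
    using u by (simp add: algebra_simps power2_eq_square)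
  \<comment> \<open>Eliminating \<open>e\<close> from \<open>ab\<close> and \<open>ie\<close> gives
    a second expression for \<open>a - i\<close>. Combined with \<open>ai\<close> it yields the
    (3,3) entry of the claim.\<close>
  have "(l2 * u) * (a - i) = l2 * (u * (a - e)) - u * (l2 * (i - e))"
    by (simp add: algebra_simps)
  then have ai': "(l1 * l3 + l2^2) * (a - i) = l2 * ((l1 - l2) * b) - u * ((l3 - l2) * f)"
    unfolding u ab ie .
  have "c * (l1 * l2) - b * (l1 * l2) + a * (l1 * l3) - (l2 * l3 * c - l3 * u * f + l1 * l3 * i) =
      ((l1 * l3 + l2^2) * (a - i) - (l2 * ((l1 - l2) * b) - u * ((l3 - l2) * f)))
      - l2 * (l2 * (a - i) - ((l1 - l3) * c + u * f - l2 * b))"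
    by (simp add: algebra_simps power2_eq_square)
  then have "c * (l1 * l2) - b * (l1 * l2) + a * (l1 * l3) =
        l2 * l3 * c - l3 * u * f + l1 * l3 * i"
    unfolding ai' ai by simp
  \<comment> \<open>These multiples of \<open>ab\<close> and \<open>ie\<close> are the (3,2) and
    (2,3) entries; the other entries agree by commutativity.\<close>
  moreover have "l3 * (u * (a - e)) = l3 * ((l1 - l2) * b)" "l1 * (l2 * (i - e)) = l1 * ((l3 - l2) * f)"
    unfolding ab ie by (rule HOL.refl)+
  then have "b * (l1 * l3) - a * (l3 * u) = l2 * l3 * b - l3 * u * e"
    "- (f * (l1 * l2)) + e * (l1 * l2) = - (l1 * l3 * f) + l1 * l2 * i"
    by (simp_all add: algebra_simps)
  ultimately show ?thesis
    unfolding P mat3_mult mat3_eq_iff by (simp add: ac_simps)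
qed

lemma
  assumes "l1 \<noteq> 0" "l2 \<noteq> 0" "l3 \<noteq> 0"
  shows invertible_mu_sigma1: "invertible (mu_sigma1 l1 l2 l3)"
    and invertible_mu_sigma2: "invertible (mu_sigma2 l1 l2 l3)"
  using assms by (simp_all add: invertible_det_nz mu_sigma1_def mu_sigma2_def det_3)

lemma hom_SB3_relations:
  assumes "\<rho> \<in> hom SB3 GL"
  defines "r \<equiv> \<lambda>x. \<rho> (gen singular_braid_rels x)"
  shows "r S\<tau>1 ** r S\<sigma>1 = r S\<sigma>1 ** r S\<tau>1"
    and "r S\<sigma>1 ** r S\<sigma>2 ** r S\<tau>1 = r S\<tau>2 ** (r S\<sigma>1 ** r S\<sigma>2)"
    and "invertible (r x)"
proof -
  let ?c = "word_class singular_braid_rels"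
  have mult: "\<rho> (?c (u @ v)) = \<rho> (?c u) ** \<rho> (?c v)" for u v
    using hom_mult[OF assms(1), of "?c u" "?c v"]
    by (simp add: SB3_def carrier_presented_group mult_word_class GL_def)
  \<comment> \<open>Treating the empty tail separately lets words unfold into products without a
    trailing image of the empty word.\<close>
  have r: "\<rho> (?c (pos x # u)) = (if u = [] then r x else r x ** \<rho> (?c u))" for x u
    using mult[of "[pos x]" u] by (auto simp: r_def gen_def)
  have rel: "\<rho> (?c u) = \<rho> (?c v)" if "(u, v) \<in> singular_braid_rels" for u v
    using word_class_relation[OF that] by simp
  have mem: "(map pos [S\<tau>1, S\<sigma>1], map pos [S\<sigma>1, S\<tau>1]) \<in> singular_braid_rels"
    "(map pos [S\<sigma>1, S\<sigma>2, S\<tau>1], map pos [S\<tau>2, S\<sigma>1, S\<sigma>2]) \<in> singular_braid_rels"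
    by (simp_all add: singular_braid_rels_def)
  show "r S\<tau>1 ** r S\<sigma>1 = r S\<sigma>1 ** r S\<tau>1"
    using rel[OF mem(1)] by (simp add: r)
  show "r S\<sigma>1 ** r S\<sigma>2 ** r S\<tau>1 = r S\<tau>2 ** (r S\<sigma>1 ** r S\<sigma>2)"
    using rel[OF mem(2)] by (simp add: r matrix_mul_assoc)
  show "invertible (r x)"
    using hom_in_carrier[OF assms(1), of "gen singular_braid_rels x"]
    by (simp add: SB3_def gen_in_carrier GL_def r_def)
qed

theorem theorem21:
  fixes l1 l2 l3 :: complex
    and \<mu> :: "braid_gen word set \<Rightarrow> complex ^ 3 ^ 3"
    and \<rho> :: "singular_braid_gen word set \<Rightarrow> complex ^ 3 ^ 3"
  assumes "l1 \<noteq> 0" and "l2 \<noteq> 0" and "l3 \<noteq> 0"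
    and "(l1^2 + l2 * l3) * (l2^2 + l1 * l3) * (l3^2 + l1 * l2) \<noteq> 0"
    and "l2 \<noteq> - l3"
    and "\<mu> \<in> hom B3 GL"
    and "\<mu> (gen braid_rels B\<sigma>1) = mu_sigma1 l1 l2 l3"
    and "\<mu> (gen braid_rels B\<sigma>2) = mu_sigma2 l1 l2 l3"
    and "\<rho> \<in> hom SB3 GL"
    and "\<rho> (gen singular_braid_rels S\<sigma>1) = \<mu> (gen braid_rels B\<sigma>1)"
    and "\<rho> (gen singular_braid_rels S\<sigma>2) = \<mu> (gen braid_rels B\<sigma>2)"
  shows "\<exists>a1 b1 c1 e1 f1 i1 a2 d2 e2 g2 h2 i2 :: complex.
      \<rho> (gen singular_braid_rels S\<tau>1) = mat3 a1 b1 c1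
                                             0  e1 f1
                                             0  0  i1 \<and>
      \<rho> (gen singular_braid_rels S\<tau>2) = mat3 a2 0  0
                                             d2 e2 0
                                             g2 h2 i2 \<and>
      a1 \<noteq> 0 \<and> e1 \<noteq> 0 \<and> i1 \<noteq> 0 \<and> a2 \<noteq> 0 \<and> e2 \<noteq> 0 \<and> i2 \<noteq> 0 \<and>
      a1 = i2 \<and>
      i2 = (c1 * l2 * (l1 - l2) * (l1 - l3) + e1 * l1 * l2 * (l2 + l3)
             + f1 * l3 * (l1 - l2) * (l1 + l2)) / (l1 * l2 * (l2 + l3)) \<and>
      b1 = - h2 \<and>
      - h2 = ((l1 * l3 + l2^2) * (c1 * l2 * (l1 - l3) + f1 * l3 * (l1 + l2)))
               / (l1 * l2^2 * (l2 + l3)) \<and>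
      i1 = a2 \<and>
      a2 = e1 + f1 * (l3 / l2 - 1) \<and>
      d2 = - f1 \<and> e2 = e1 \<and> g2 = c1"
proof -
  let ?r = "\<lambda>x. \<rho> (gen singular_braid_rels x)"
  let ?P = "mu_sigma1 l1 l2 l3 ** mu_sigma2 l1 l2 l3"
  note nz = assms(1-5)
  have sigma: "?r S\<sigma>1 = mu_sigma1 l1 l2 l3" "?r S\<sigma>2 = mu_sigma2 l1 l2 l3"
    using assms by simp_all
  note rels = hom_SB3_relations[OF assms(9), unfolded sigma]
  define u where "u = l1 * inverse l2 * l3 + l2"
  have u: "l2 * u = l1 * l3 + l2^2"
    using nz by (simp add: u_def field_simps power2_eq_square)
  then have "u \<noteq> 0" using nz by (auto simp: add.commute)
  have "l2 + l3 \<noteq> 0" using nz by (simp add: add_eq_0_iff2)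
  obtain a b c d e f g h i where T1': "?r S\<tau>1 = mat3 a b c d e f g h i"
    by (rule mat3_surj)
  have "l2^2 + l1 * l3 \<noteq> 0" using nz by simp
  note entries = mu_sigma1_commute[OF nz(1-3) this nz(5) rels(1)[unfolded T1']]
  note lin = entries(4-6)
  have T1: "?r S\<tau>1 = mat3 a b c 0 e f 0 0 i"
    using T1' entries(1-3) by simp
  have "invertible ?P"
    using nz by (intro invertible_mult invertible_mu_sigma1 invertible_mu_sigma2)
  then obtain Q where Q: "?P ** Q = mat 1" unfolding invertible_def by blast
  have "?r S\<tau>2 ** ?P = mat3 i 0 0 (- f) e 0 c (- b) a ** ?P"
    using rels(2) mu_intertwines[OF nz(2) lin] T1 by simp
  \<comment> \<open>Multiplying by \<open>Q\<close> on the right cancels \<open>?P\<close>.\<close>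
  then have T2: "?r S\<tau>2 = mat3 i 0 0 (- f) e 0 c (- b) a"
    using Q by (metis matrix_mul_assoc matrix_mul_rid)
  have nonzero: "a \<noteq> 0" "e \<noteq> 0" "i \<noteq> 0"
    using rels(3)[of S\<tau>1] by (simp_all add: T1 invertible_det_nz det_3)
  note formulas = centralizer_entries[OF nz(1,2) \<open>l2 + l3 \<noteq> 0\<close> \<open>u \<noteq> 0\<close> u lin[folded u_def]]
  show ?thesis
    \<comment> \<open>Unification with \<open>T1\<close> and \<open>T2\<close> fixes all twelve
      witnesses. Shared variables make the equalities between entries of the two matrices trivial,
      leaving nonvanishing and the three formulas.\<close>
    by (intro exI conjI, rule T1, rule T2)
      (simp_all only: minus_minus nonzero not_False_eq_True, (rule formulas)+)
qed

end
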